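(* For every $d>0$, the threshold of the property "Class $0$" satisfies $th(\text{Class }0)\subseteq o\big((n\lg n)^{1/d}/n\big)$.
   Context: For a finite graph $\mathbf{G}=(V,E)$, a pebbling is a function $\phi:V\to\mathbb{N}_0$; its size is $\sum_{x\in V}\phi(x)$. A pebbling move takes a vertex $x$ with $\phi(x)\ge 2$, removes two pebbles from $x$ and adds one pebble to a neighbor $y$ of $x$. A descendant of $\phi$ is any pebbling obtained from $\phi$ by a finite sequence of pebbling moves. $\phi$ has the potential to pebble $x$ if $\phi$ or a descendant places a pebble on $x$. The pebbling number $f(\mathbf{G})$ is the least $p$ such that every pebbling of size $p$ has the potential to pebble every vertex. $\mathbf{G}$ is Class $0$ if $f(\mathbf{G})=|V|$. Let $\mathcal{G}_{n,p}$ denote the random graph on $n$ vertices in which each of the $\binom n2$ possible edges appears independently with probability $p=p(n)$. For functions $f,g$ of $n$, write $f\ll g$ if $f/g\to 0$ as $n\to\infty$, and $o(g)=\{f: f\ll g\}$. For a graph property $\mathcal{P}$, the threshold $th(\mathcal{P})$ is the set of functions $t$ such that $p\gg t$ implies $\Pr(\mathcal{G}_{n,p}\text{ has }\mathcal{P})\to 1$ and $p\ll t$ implies $\Pr(\mathcal{G}_{n,p}\text{ has }\mathcal{P})\to 0$ as $n\to\infty$. Here $\lg$ denotes the logarithm. *)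

theory Defs
  imports "HOL-Probability.Probability" "HOL-Library.Landau_Symbols" "HOL-Library.Extended_Nat"
begin

type_synonym 'a graph = "'a set \<times> 'a set set"

definition all_edges :: "'a set \<Rightarrow> 'a set set" where
  "all_edges V = {e. e \<subseteq> V \<and> card e = 2}"

definition is_graph :: "'a graph \<Rightarrow> bool" where
  "is_graph G \<longleftrightarrow> finite (fst G) \<and> snd G \<subseteq> all_edges (fst G)"

(* A pebbling of G is a total function whose values off the vertex set are irrelevant:
   they do not count towards the size, and edges lie inside the vertex set. *)
definition pebbling_size :: "'a graph \<Rightarrow> ('a \<Rightarrow> nat) \<Rightarrow> nat" where
  "pebbling_size G \<phi> = (\<Sum>x\<in>fst G. \<phi> x)"

definition pebbling_move :: "'a graph \<Rightarrow> ('a \<Rightarrow> nat) \<Rightarrow> ('a \<Rightarrow> nat) \<Rightarrow> bool" where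
  "pebbling_move G \<phi> \<psi> \<longleftrightarrow>
     (\<exists>x\<in>fst G. \<exists>y\<in>fst G. x \<noteq> y \<and> {x, y} \<in> snd G \<and> \<phi> x \<ge> 2 \<and>
        \<psi> = \<phi>(x := \<phi> x - 2, y := \<phi> y + 1))"

definition can_pebble :: "'a graph \<Rightarrow> ('a \<Rightarrow> nat) \<Rightarrow> 'a \<Rightarrow> bool" where
  "can_pebble G \<phi> x \<longleftrightarrow> (\<exists>\<psi>. (pebbling_move G)\<^sup>*\<^sup>* \<phi> \<psi> \<and> \<psi> x \<ge> 1)"

(* The infimum is a minimum whenever some p qualifies; if none does (G disconnected),
   it is infinity, so that a disconnected graph is never Class 0. *)
definition pebbling_number :: "'a graph \<Rightarrow> enat" where
  "pebbling_number G =
     (INF p \<in> {p. \<forall>\<phi>. pebbling_size G \<phi> = p \<longrightarrow> (\<forall>x\<in>fst G. can_pebble G \<phi> x)}. enat p)"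

definition class0 :: "'a graph \<Rightarrow> bool" where
  "class0 G \<longleftrightarrow> is_graph G \<and> pebbling_number G = enat (card (fst G))"

definition random_graph :: "nat \<Rightarrow> real \<Rightarrow> nat graph pmf" where
  "random_graph n p =
     map_pmf (\<lambda>f. ({..<n}, {e \<in> all_edges {..<n}. f e}))
       (Pi_pmf (all_edges {..<n}) False (\<lambda>_. bernoulli_pmf p))"

definition prob_property :: "(nat graph \<Rightarrow> bool) \<Rightarrow> nat \<Rightarrow> real \<Rightarrow> real" where
  "prob_property P n p = measure_pmf.prob (random_graph n p) {G. P G}"

(* Membership in o(_) renders the relation "much less than": it agrees with f n / g n tending
   to 0 whenever g is eventually nonzero, and forces f to vanish eventually wherever g does. *)
definition threshold :: "(nat graph \<Rightarrow> bool) \<Rightarrow> (nat \<Rightarrow> real) set" where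
  "threshold P =
     {t. (\<forall>p :: nat \<Rightarrow> real. (\<forall>n. 0 \<le> p n \<and> p n \<le> 1) \<and> t \<in> o(p) \<longrightarrow>
             (\<lambda>n. prob_property P n (p n)) \<longlonglongrightarrow> 1) \<and>
         (\<forall>p :: nat \<Rightarrow> real. (\<forall>n. 0 \<le> p n \<and> p n \<le> 1) \<and> p \<in> o(t) \<longrightarrow>
             (\<lambda>n. prob_property P n (p n)) \<longlonglongrightarrow> 0)}"

end

theory Submission
  imports Defs "HOL-Real_Asymp.Real_Asymp"
begin

text \<open>
  For every \<open>e > 0\<close> the random graph with \<open>p = n powr (e - 1)\<close> is Class 0 with high probability, which
  excludes thresholds exceeding \<open>p\<close> infinitely often. By a union bound all vertex sets \<open>S\<close> satisfy
  \<open>|N[S]| \<ge> min (K |S|) ((1 - \<beta>) n)\<close> with \<open>K = n powr (e / 2)\<close>, so the diameter is at most a constant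
  \<open>2 k\<close> and \<open>m = 2 ^ (2 k)\<close> pebbles on one vertex suffice to reach every vertex.

  Take \<open>n\<close> pebbles, at most \<open>m\<close> on each vertex. Then the empty vertices are at most \<open>m\<close> times as many
  as the set \<open>B\<close> of vertices with two or more pebbles. A vertex of \<open>B\<close> can push a pebble along any path
  of nonempty vertices. If \<open>B\<close> has at least \<open>m\<close> elements, expansion yields \<open>m\<close> disjoint sets reachable
  from \<open>B\<close> in this way, each adjacent to almost all vertices; a common neighbour collects \<open>m\<close> pebbles.
  Otherwise boundedly many vertices are empty, and deleting them cannot separate the target from \<open>B\<close>.
\<close>

subsection \<open>Pebbling moves and charged sets\<close>

definition nbhd :: "'a graph \<Rightarrow> 'a set \<Rightarrow> 'a set" where
  "nbhd G S = S \<union> {y. \<exists>x\<in>S. {x, y} \<in> snd G}"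

text \<open>The diagonal is included so that powers of the relation describe balls rather than spheres.\<close>

definition adj_rel :: "'a graph \<Rightarrow> 'a rel" where
  "adj_rel G = {(x, y). x = y \<or> {x, y} \<in> snd G}"

text \<open>The minimum lets one condition serve twice: small sets grow by the factor
  \<open>K\<close>, and larger ones have closed neighbourhoods that miss at most a fraction \<beta>
  of the vertices.\<close>

definition expanding :: "real \<Rightarrow> real \<Rightarrow> 'a graph \<Rightarrow> bool" where
  "expanding K \<beta> G \<longleftrightarrow> (\<forall>S \<subseteq> fst G. S \<noteq> {} \<longrightarrow>
     min (K * card S) ((1 - \<beta>) * card (fst G)) \<le> card (nbhd G S))"

text \<open>
  A charged set can bring two pebbles to any of its vertices without touching the rest of the graph.
  Quantifying over all \<open>\<phi>'\<close> that agree with \<open>\<phi>\<close> on \<open>T\<close> makes the moves of disjoint charged sets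
  independent of each other.
\<close>

definition charged :: "'a graph \<Rightarrow> ('a \<Rightarrow> nat) \<Rightarrow> 'a set \<Rightarrow> bool" where
  "charged G \<phi> T \<longleftrightarrow> (\<forall>\<phi>'. (\<forall>x\<in>T. \<phi>' x = \<phi> x) \<longrightarrow>
     (\<forall>u\<in>T. \<exists>\<psi>. (pebbling_move G)\<^sup>*\<^sup>* \<phi>' \<psi> \<and> 2 \<le> \<psi> u \<and> (\<forall>x. x \<notin> T \<longrightarrow> \<psi> x = \<phi>' x)))"

lemma is_graph_edgeD:
  assumes "is_graph G" "{x, y} \<in> snd G"
  shows "x \<in> fst G" "y \<in> fst G" "x \<noteq> y"
proof -
  have "{x, y} \<subseteq> fst G \<and> card {x, y} = 2"
    using assms unfolding is_graph_def all_edges_def by blast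
  then show "x \<in> fst G" "y \<in> fst G" "x \<noteq> y" by auto
qed

lemma nbhd_subset:
  assumes "is_graph G" "S \<subseteq> fst G"
  shows "nbhd G S \<subseteq> fst G"
  using assms is_graph_edgeD(2)[OF assms(1)] unfolding nbhd_def by blast

lemma subset_nbhd: "S \<subseteq> nbhd G S"
  unfolding nbhd_def by blast

lemma nbhd_eq_Image: "nbhd G S = adj_rel G `` S"
  unfolding nbhd_def adj_rel_def by blast

lemma sym_adj_rel: "sym (adj_rel G)"
  unfolding adj_rel_def sym_def by (auto simp: insert_commute)

lemma sym_relpow:
  assumes "sym R"
  shows "sym (R ^^ n)"
proof (induction n)
  case (Suc n)
  have "(R ^^ Suc n)\<inverse> = R\<inverse> O (R ^^ n)\<inverse>" by (simp add: converse_relcomp)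
  also have "\<dots> = R O R ^^ n" using assms Suc by (simp add: sym_conv_converse_eq)
  also have "\<dots> = R ^^ Suc n" by (simp add: relpow_commute)
  finally show ?case by (simp add: sym_conv_converse_eq)
qed (simp add: sym_Id)

section \<open>Moving pebbles along edges and walks\<close>

lemma moves_along_edge:
  assumes G: "is_graph G" and e: "{u, w} \<in> snd G" and "2 * c \<le> \<phi> u"
  shows "\<exists>\<psi>. (pebbling_move G)\<^sup>*\<^sup>* \<phi> \<psi> \<and> \<psi> w = \<phi> w + c \<and> (\<forall>x. x \<noteq> u \<longrightarrow> x \<noteq> w \<longrightarrow> \<psi> x = \<phi> x)"
  using assms(3)
proof (induction c arbitrary: \<phi>)
  case 0
  then show ?case by auto
next
  case (Suc c)
  note E = is_graph_edgeD[OF G e]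
  define \<phi>' where "\<phi>' = \<phi>(u := \<phi> u - 2, w := \<phi> w + 1)"
  have mv: "pebbling_move G \<phi> \<phi>'"
    unfolding pebbling_move_def \<phi>'_def using E e Suc.prems by force
  have "2 * c \<le> \<phi>' u" using Suc.prems E unfolding \<phi>'_def by simp
  from Suc.IH[of \<phi>', OF this] obtain \<psi> where \<psi>: "(pebbling_move G)\<^sup>*\<^sup>* \<phi>' \<psi>" "\<psi> w = \<phi>' w + c"
    "\<forall>x. x \<noteq> u \<longrightarrow> x \<noteq> w \<longrightarrow> \<psi> x = \<phi>' x" by blast
  have "(pebbling_move G)\<^sup>*\<^sup>* \<phi> \<psi>" using mv \<psi>(1) by (rule converse_rtranclp_into_rtranclp)
  moreover have "\<psi> w = \<phi> w + Suc c" using \<psi>(2) unfolding \<phi>'_def by simp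
  moreover have "\<forall>x. x \<noteq> u \<longrightarrow> x \<noteq> w \<longrightarrow> \<psi> x = \<phi> x" using \<psi>(3) unfolding \<phi>'_def by simp
  ultimately show ?case by blast
qed

text \<open>Every edge costs half of the pebbles; the steps that stay in place, allowed by the
  diagonal, cost nothing. The amount \<open>c\<close> varies in the induction because the last but
  one vertex must receive \<open>2 * c\<close>.\<close>

lemma moves_along_walk:
  assumes G: "is_graph G" and "(v, w) \<in> adj_rel G ^^ j" and "2 ^ j * c \<le> \<phi> v"
  shows "\<exists>\<psi>. (pebbling_move G)\<^sup>*\<^sup>* \<phi> \<psi> \<and> c \<le> \<psi> w"
  using assms(2,3)
proof (induction j arbitrary: c w)
  case 0
  then show ?case by auto
next
  case (Suc j)
  from Suc.prems(1) obtain u where u: "(v, u) \<in> adj_rel G ^^ j" "(u, w) \<in> adj_rel G"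
    by auto
  have "2 ^ j * (2 * c) \<le> \<phi> v" using Suc.prems(2) by (simp add: mult_ac)
  from Suc.IH[OF u(1) this] obtain \<psi> where \<psi>: "(pebbling_move G)\<^sup>*\<^sup>* \<phi> \<psi>" "2 * c \<le> \<psi> u" by blast
  show ?case
  proof (cases "u = w")
    case True
    have "c \<le> \<psi> w" using \<psi>(2) True by simp
    then show ?thesis using \<psi>(1) by blast
  next
    case False
    then have "{u, w} \<in> snd G" using u(2) unfolding adj_rel_def by auto
    from moves_along_edge[where \<phi>=\<psi>, OF G this \<psi>(2)] obtain \<psi>' where
      "(pebbling_move G)\<^sup>*\<^sup>* \<psi> \<psi>'" "\<psi>' w = \<psi> w + c" by blast
    then show ?thesis using \<psi>(1) by (metis le_add2 rtranclp_trans)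
  qed
qed

section \<open>Charged sets\<close>

lemma charged_if_ge_2: "\<forall>x\<in>T. 2 \<le> \<phi> x \<Longrightarrow> charged G \<phi> T"
  unfolding charged_def by (metis rtranclp.rtrancl_refl)

lemma charged_cong: "charged G \<phi> T \<Longrightarrow> \<forall>x\<in>T. \<phi>' x = \<phi> x \<Longrightarrow> charged G \<phi>' T"
  unfolding charged_def by simp

text \<open>The charge brings two pebbles to a neighbour of \<open>v\<close> inside
  \<open>T\<close>, and these pay for one move onto \<open>v\<close>. Since \<open>v\<close> is
  outside \<open>T\<close>, its own pebbles survive. The frame condition allows deliveries from
  disjoint sets to be chained.\<close>

lemma charged_deliver:
  assumes G: "is_graph G" and T: "charged G \<phi> T" and v: "v \<in> nbhd G T - T"
    and \<phi>': "\<forall>x\<in>T. \<phi>' x = \<phi> x"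
  shows "\<exists>\<psi>. (pebbling_move G)\<^sup>*\<^sup>* \<phi>' \<psi> \<and> \<psi> v = \<phi>' v + 1 \<and> (\<forall>x. x \<notin> T \<longrightarrow> x \<noteq> v \<longrightarrow> \<psi> x = \<phi>' x)"
proof -
  from v obtain u where u: "u \<in> T" "{u, v} \<in> snd G" unfolding nbhd_def by auto
  from T u(1) \<phi>' obtain \<psi> where \<psi>: "(pebbling_move G)\<^sup>*\<^sup>* \<phi>' \<psi>" "2 \<le> \<psi> u" "\<forall>x. x \<notin> T \<longrightarrow> \<psi> x = \<phi>' x"
    unfolding charged_def by blast
  have "2 * 1 \<le> \<psi> u" using \<psi>(2) by simp
  from moves_along_edge[where \<phi>=\<psi>, OF G u(2) this] obtain \<psi>' where \<psi>': "(pebbling_move G)\<^sup>*\<^sup>* \<psi> \<psi>'"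
    "\<psi>' v = \<psi> v + 1" "\<forall>x. x \<noteq> u \<longrightarrow> x \<noteq> v \<longrightarrow> \<psi>' x = \<psi> x" by blast
  have "(pebbling_move G)\<^sup>*\<^sup>* \<phi>' \<psi>'" using \<psi>(1) \<psi>'(1) by (rule rtranclp_trans)
  moreover have "\<psi>' v = \<phi>' v + 1" using \<psi>'(2) \<psi>(3) v by simp
  moreover have "\<forall>x. x \<notin> T \<longrightarrow> x \<noteq> v \<longrightarrow> \<psi>' x = \<phi>' x" using \<psi>'(3) \<psi>(3) u(1) by metis
  ultimately show ?thesis by blast
qed

text \<open>The pebble already on \<open>w\<close> and the one delivered from \<open>T\<close> make
  two. In this way charge spreads along nonempty vertices.\<close>

lemma charged_insert:
  assumes G: "is_graph G" and T: "charged G \<phi> T" and w: "w \<in> nbhd G T - T" and "1 \<le> \<phi> w"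
  shows "charged G \<phi> (insert w T)"
  unfolding charged_def
proof (intro allI impI ballI)
  fix \<phi>' u assume \<phi>': "\<forall>x\<in>insert w T. \<phi>' x = \<phi> x" and u: "u \<in> insert w T"
  show "\<exists>\<psi>. (pebbling_move G)\<^sup>*\<^sup>* \<phi>' \<psi> \<and> 2 \<le> \<psi> u \<and> (\<forall>x. x \<notin> insert w T \<longrightarrow> \<psi> x = \<phi>' x)"
  proof (cases "u = w")
    case True
    from charged_deliver[OF G T w] \<phi>' obtain \<psi> where
      \<psi>: "(pebbling_move G)\<^sup>*\<^sup>* \<phi>' \<psi>" "\<psi> w = \<phi>' w + 1" "\<forall>x. x \<notin> T \<longrightarrow> x \<noteq> w \<longrightarrow> \<psi> x = \<phi>' x"
      by blast
    have "2 \<le> \<psi> u" using \<psi>(2) \<phi>' assms(4) True by simp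
    then show ?thesis using \<psi>(1,3) by blast
  next
    case False
    then have "u \<in> T" using u by blast
    then obtain \<psi> where "(pebbling_move G)\<^sup>*\<^sup>* \<phi>' \<psi>" "2 \<le> \<psi> u" "\<forall>x. x \<notin> T \<longrightarrow> \<psi> x = \<phi>' x"
      using T \<phi>' unfolding charged_def by blast
    then show ?thesis by blast
  qed
qed

text \<open>A delivery alters only its own set and \<open>v\<close>, so by disjointness the
  remaining sets keep their charge and each contributes a further pebble.\<close>

lemma charged_family_deliver:
  assumes G: "is_graph G" and "finite I" and "\<forall>i\<in>I. charged G \<phi> (T i)"
    and "disjoint_family_on T I" and "\<forall>i\<in>I. v \<in> nbhd G (T i) - T i"
  shows "\<exists>\<psi>. (pebbling_move G)\<^sup>*\<^sup>* \<phi> \<psi> \<and> \<psi> v = \<phi> v + card I"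
  using assms(2-5)
proof (induction I arbitrary: \<phi> rule: finite_induct)
  case empty
  then show ?case by auto
next
  case (insert i I)
  have "charged G \<phi> (T i)" "v \<in> nbhd G (T i) - T i" using insert.prems by auto
  from charged_deliver[OF G this] obtain \<psi> where \<psi>: "(pebbling_move G)\<^sup>*\<^sup>* \<phi> \<psi>" "\<psi> v = \<phi> v + 1"
    "\<forall>x. x \<notin> T i \<longrightarrow> x \<noteq> v \<longrightarrow> \<psi> x = \<phi> x" by blast
  have ch: "\<forall>j\<in>I. charged G \<psi> (T j)"
  proof
    fix j assume j: "j \<in> I"
    then have "T i \<inter> T j = {}"
      using insert.prems(2) insert.hyps(2) unfolding disjoint_family_on_def by auto
    then have "\<forall>x\<in>T j. \<psi> x = \<phi> x" using \<psi>(3) insert.prems(3) j by blast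
    then show "charged G \<psi> (T j)" using insert.prems(1) j charged_cong by blast
  qed
  have dis: "disjoint_family_on T I" using insert.prems(2) unfolding disjoint_family_on_def by blast
  have "\<forall>j\<in>I. v \<in> nbhd G (T j) - T j" using insert.prems(3) by blast
  from insert.IH[OF ch dis this] obtain \<psi>' where
    "(pebbling_move G)\<^sup>*\<^sup>* \<psi> \<psi>'" "\<psi>' v = \<psi> v + card I" by blast
  then show ?case using \<psi>(1,2) insert.hyps
    by (intro exI[of _ \<psi>']) (auto intro: rtranclp_trans)
qed

subsection \<open>Pebbling in expanding graphs\<close>

text \<open>The next ball is the closed neighbourhood of the current one. It is larger by the factor
  \<open>K\<close> until the cap is reached, and from then on balls do not shrink.\<close>

lemma expanding_ball:
  assumes G: "is_graph G" and X: "expanding K \<beta> G" and K: "1 \<le> K" and v: "v \<in> fst G"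
  shows "(adj_rel G ^^ j) `` {v} \<subseteq> fst G \<and> v \<in> (adj_rel G ^^ j) `` {v} \<and>
    min (K ^ j) ((1 - \<beta>) * card (fst G)) \<le> card ((adj_rel G ^^ j) `` {v})"
proof (induction j)
  case 0
  then show ?case using v by auto
next
  case (Suc j)
  let ?S = "(adj_rel G ^^ j) `` {v}" and ?n = "(1 - \<beta>) * card (fst G)"
  have eq: "(adj_rel G ^^ Suc j) `` {v} = nbhd G ?S"
    by (simp add: nbhd_eq_Image relcomp_Image)
  have fin: "finite (nbhd G ?S)"
    using finite_subset[OF nbhd_subset[OF G conjunct1[OF Suc]]] G unfolding is_graph_def by simp
  have le: "card ?S \<le> card (nbhd G ?S)" by (rule card_mono[OF fin subset_nbhd])
  have ne: "?S \<noteq> {}" using Suc by blast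
  have X': "min (K * card ?S) ?n \<le> card (nbhd G ?S)"
    using X Suc ne unfolding expanding_def by blast
  have "min (K ^ Suc j) ?n \<le> card (nbhd G ?S)"
  proof (cases "K ^ j \<le> card ?S")
    case True
    then have "K ^ Suc j \<le> K * card ?S" using K by simp
    then show ?thesis using X' by linarith
  next
    case False
    then have "?n \<le> card ?S" using Suc by linarith
    then show ?thesis using le by linarith
  qed
  moreover have "nbhd G ?S \<subseteq> fst G" by (rule nbhd_subset[OF G conjunct1[OF Suc]])
  moreover have "v \<in> nbhd G ?S" by (rule subsetD[OF subset_nbhd]) (use Suc in simp)
  ultimately show ?case by (simp only: eq)
qed

text \<open>At radius \<open>k\<close> the cap is the smaller term of the minimum, so each ball
  holds more than half of the vertices. Two such balls meet, and symmetry joins the two walks to a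
  common vertex.\<close>

lemma expanding_diameter:
  fixes K \<beta> :: real
  assumes G: "is_graph G" and X: "expanding K \<beta> G" and K: "1 \<le> K"
    and k: "card (fst G) \<le> K ^ k" and \<beta>: "0 < \<beta>" "\<beta> < 1 / 2" and v: "v \<in> fst G" and w: "w \<in> fst G"
  shows "(v, w) \<in> adj_rel G ^^ (2 * k)"
proof -
  let ?S = "\<lambda>v. (adj_rel G ^^ k) `` {v}"
  have fin: "finite (fst G)" using G unfolding is_graph_def by blast
  have pos: "0 < card (fst G)" using fin v by (auto simp: card_gt_0_iff)
  have half: "card (fst G) < 2 * card (?S x) \<and> ?S x \<subseteq> fst G" if x: "x \<in> fst G" for x
  proof -
    note b = expanding_ball[OF G X K x, of k]
    have "1 / 2 * real (card (fst G)) < (1 - \<beta>) * card (fst G)"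
      using \<beta> pos by (intro mult_strict_right_mono) auto
    then have "real (card (fst G)) < 2 * ((1 - \<beta>) * card (fst G))" by linarith
    moreover have "(1 - \<beta>) * card (fst G) \<le> card (fst G)"
      using \<beta> by (simp add: mult_left_le_one_le)
    ultimately have "real (card (fst G)) < 2 * card (?S x)" using b k by linarith
    then show ?thesis using b by linarith
  qed
  have "?S v \<inter> ?S w \<noteq> {}"
  proof
    assume "?S v \<inter> ?S w = {}"
    then have "card (?S v) + card (?S w) = card (?S v \<union> ?S w)"
      using half[OF v] half[OF w] fin finite_subset by (metis card_Un_disjoint)
    also have "\<dots> \<le> card (fst G)" using half[OF v] half[OF w] fin by (intro card_mono) auto
    finally show False using half[OF v] half[OF w] by linarith
  qed
  then obtain u where "(v, u) \<in> adj_rel G ^^ k" "(w, u) \<in> adj_rel G ^^ k" by blast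
  then have "(v, u) \<in> adj_rel G ^^ k" "(u, w) \<in> adj_rel G ^^ k"
    using symD[OF sym_relpow[OF sym_adj_rel]] by metis+
  then show ?thesis by (auto simp: mult_2 relpow_add)
qed

section \<open>Disjoint charged sets and a common neighbour\<close>

lemma disjoint_subsets_of_card:
  assumes "finite B" "m * s \<le> card B"
  shows "\<exists>T. (\<forall>i<m. T i \<subseteq> B \<and> card (T i) = s) \<and> disjoint_family_on T {..<m}"
proof -
  obtain h where h: "bij_betw h {0..<card B} B"
    using ex_bij_betw_nat_finite[OF assms(1)] by blast
  \<comment> \<open>Consecutive blocks of length \<open>s\<close> in an enumeration of
    \<open>B\<close>.\<close>
  define T where "T i = h ` {i * s..<(i + 1) * s}" for i
  have sub: "{i * s..<(i + 1) * s} \<subseteq> {0..<card B}" if "i < m" for i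
  proof -
    have "(i + 1) * s \<le> m * s" using that by (intro mult_le_mono1) simp
    then show ?thesis using assms(2) by auto
  qed
  have "T i \<subseteq> B \<and> card (T i) = s" if "i < m" for i
    using sub[OF that] h unfolding T_def bij_betw_def
    by (auto simp: card_image inj_on_subset)
  moreover have "T i \<inter> T j = {}" if "i < m" "j < m" "i \<noteq> j" for i j
  proof -
    have "{i * s..<(i + 1) * s} \<inter> {j * s..<(j + 1) * s} = {}"
    proof (cases "i < j")
      case True
      then have "(i + 1) * s \<le> j * s" by (intro mult_le_mono1) simp
      then show ?thesis by auto
    next
      case False
      then have "(j + 1) * s \<le> i * s" using that by (intro mult_le_mono1) simp
      then show ?thesis by auto
    qed
    then show ?thesis
      using inj_on_image_Int[of h "{0..<card B}", OF _ sub[OF that(1)] sub[OF that(2)]] h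
      unfolding T_def bij_betw_def by auto
  qed
  ultimately show ?thesis unfolding disjoint_family_on_def by (intro exI[of _ T]) auto
qed

text \<open>
  The sets are grown from \<open>B\<close> one vertex at a time, always at a smallest one. Keeping their sizes
  within one of each other bounds the forbidden vertices (the empty ones and those already used) by
  a constant multiple of the smallest set, which expansion beats.
\<close>

lemma balanced_charged_family:
  fixes K \<beta> :: real and m s\<^sub>0 z :: nat
  assumes G: "is_graph G" and X: "expanding K \<beta> G" and "0 < K" and "1 \<le> m" and s0: "1 \<le> s\<^sub>0"
    and B: "B \<subseteq> fst G" "\<forall>b\<in>B. 2 \<le> \<phi> b" "m * s\<^sub>0 \<le> card B"
    and Z: "card {x \<in> fst G. \<phi> x = 0} \<le> z"
    and K: "\<And>s. s\<^sub>0 \<le> s \<Longrightarrow> real (z + m * (s + 1)) < K * s"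
  shows "\<exists>T. (\<forall>i<m. T i \<subseteq> fst G \<and> charged G \<phi> (T i) \<and>
      (1 - \<beta>) * card (fst G) \<le> card (nbhd G (T i))) \<and> disjoint_family_on T {..<m}"
proof -
  let ?V = "fst G"
  have finV: "finite ?V" using G unfolding is_graph_def by blast
  have finB: "finite B" using finite_subset[OF B(1) finV] .
  define P where "P T \<longleftrightarrow> (\<forall>i<m. T i \<subseteq> ?V \<and> charged G \<phi> (T i) \<and> s\<^sub>0 \<le> card (T i)) \<and>
    disjoint_family_on T {..<m} \<and> (\<forall>i<m. \<forall>j<m. card (T i) \<le> card (T j) + 1)" for T
  have "\<exists>T. P T"
  proof -
    from disjoint_subsets_of_card[OF finB B(3)] obtain T where
      T: "\<forall>i<m. T i \<subseteq> B \<and> card (T i) = s\<^sub>0" "disjoint_family_on T {..<m}" by blast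
    have "charged G \<phi> (T i)" if "i < m" for i
      using T(1) B(2) that by (intro charged_if_ge_2) blast
    then have "P T" unfolding P_def using T B(1) by (auto 4 3)
    then show ?thesis by blast
  qed
  then obtain T0 where "P T0" by blast
  have bound: "(\<Sum>i<m. card (T i)) \<le> m * card ?V" if "P T" for T
  proof -
    have "(\<Sum>i<m. card (T i)) \<le> (\<Sum>i<m. card ?V)"
      using that finV unfolding P_def by (intro sum_mono card_mono) auto
    then show ?thesis by simp
  qed
  \<comment> \<open>An extremal choice replaces the growing process: total sizes are bounded, so
    some admissible family has the greatest total.\<close>
  have "\<exists>T. P T \<and> (\<forall>T'. P T' \<longrightarrow> (\<Sum>i<m. card (T' i)) \<le> (\<Sum>i<m. card (T i)))"
    by (rule ex_has_greatest_nat[of P, OF \<open>P T0\<close>, where b = "Suc (m * card ?V)"])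
      (use bound in \<open>auto simp: less_Suc_eq_le\<close>)
  then obtain T where PT: "P T"
    and max: "\<And>T'. P T' \<Longrightarrow> (\<Sum>i<m. card (T' i)) \<le> (\<Sum>i<m. card (T i))" by auto
  have T: "\<And>i. i < m \<Longrightarrow> T i \<subseteq> ?V" "\<And>i. i < m \<Longrightarrow> charged G \<phi> (T i)"
      "\<And>i. i < m \<Longrightarrow> s\<^sub>0 \<le> card (T i)" "disjoint_family_on T {..<m}"
      "\<And>i j. i < m \<Longrightarrow> j < m \<Longrightarrow> card (T i) \<le> card (T j) + 1"
    using PT unfolding P_def by blast+
  have finT: "finite (T i)" if "i < m" for i using finite_subset[OF T(1)[OF that] finV] .
  obtain l where l: "l < m" and lmin: "\<And>i. i < m \<Longrightarrow> card (T l) \<le> card (T i)"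
    using ex_is_arg_min_if_finite[of "{..<m}" "\<lambda>i. card (T i)"] \<open>1 \<le> m\<close>
    unfolding is_arg_min_linorder by (auto simp: lessThan_empty_iff)
  have big: "(1 - \<beta>) * card ?V \<le> K * card (T l)"
  proof (rule ccontr)
    assume neg: "\<not> ?thesis"
    have "T l \<noteq> {}" using T(3)[OF l] s0 by auto
    then have "K * card (T l) \<le> card (nbhd G (T l))"
      using X T(1)[OF l] neg unfolding expanding_def by (metis linorder_not_le min.absorb1 less_imp_le)
    then have "real (z + m * (card (T l) + 1)) < card (nbhd G (T l))"
      using K[OF T(3)[OF l]] by linarith
    then have lt: "z + m * (card (T l) + 1) < card (nbhd G (T l))" by linarith
    let ?W = "{x \<in> ?V. \<phi> x = 0} \<union> (\<Union>i<m. T i)"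
    have "card (\<Union>i<m. T i) \<le> (\<Sum>i<m. card (T i))" by (rule card_UN_le) simp
    \<comment> \<open>Balance enters here: the space used by all sets is controlled by the smallest
      one.\<close>
    also have "\<dots> \<le> (\<Sum>i<m. card (T l) + 1)" by (rule sum_mono) (use T(5) l in auto)
    finally have "card (\<Union>i<m. T i) \<le> m * (card (T l) + 1)" by simp
    moreover have "card ?W \<le> card {x \<in> ?V. \<phi> x = 0} + card (\<Union>i<m. T i)" by (rule card_Un_le)
    ultimately have "card ?W < card (nbhd G (T l))" using Z lt by linarith
    moreover have "finite ?W" using finV finT by auto
    ultimately have "\<not> nbhd G (T l) \<subseteq> ?W" using card_mono by (metis linorder_not_le)
    then obtain w where w: "w \<in> nbhd G (T l)" "w \<notin> ?W" by blast
    have wV: "w \<in> ?V" using w(1) nbhd_subset[OF G T(1)[OF l]] by blast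
    have wnot: "w \<notin> T i" if "i < m" for i using w(2) that by blast
    define T' where "T' = T(l := insert w (T l))"
    have card': "card (T' l) = card (T l) + 1" using finT[OF l] wnot[OF l] unfolding T'_def by simp
    have other: "T' i = T i" if "i \<noteq> l" for i using that unfolding T'_def by simp
    have "charged G \<phi> (T' l)" unfolding T'_def
      using charged_insert[OF G T(2)[OF l], of w] w wV wnot[OF l] by auto
    moreover have "T' l \<subseteq> ?V" using T(1)[OF l] wV unfolding T'_def by simp
    ultimately have 1: "T' i \<subseteq> ?V \<and> charged G \<phi> (T' i) \<and> s\<^sub>0 \<le> card (T' i)" if "i < m" for i
      using T(1-3)[OF that] card' other[of i] T(3)[OF l] by (cases "i = l") auto
    have 2: "disjoint_family_on T' {..<m}"
      unfolding disjoint_family_on_def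
    proof (intro ballI impI)
      fix i j assume "i \<in> {..<m}" "j \<in> {..<m}" "i \<noteq> j"
      then show "T' i \<inter> T' j = {}"
        using T(4) wnot unfolding disjoint_family_on_def T'_def by (cases "i = l"; cases "j = l") auto
    qed
    \<comment> \<open>Only a smallest set was enlarged, so the sizes still differ by at most
      one.\<close>
    have 3: "card (T' i) \<le> card (T' j) + 1" if "i < m" "j < m" for i j
      using T(5)[OF that] lmin[OF that(1)] lmin[OF that(2)] T(5)[OF that(1) l] card' other[of i] other[of j]
      by (cases "i = l"; cases "j = l") auto
    have "P T'" unfolding P_def using 1 2 3 by blast
    from max[OF this] have "(\<Sum>i<m. card (T' i)) \<le> (\<Sum>i<m. card (T i))" .
    moreover have "(\<Sum>i<m. card (T i)) < (\<Sum>i<m. card (T' i))"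
    proof (rule sum_strict_mono_ex1)
      show "\<forall>i\<in>{..<m}. card (T i) \<le> card (T' i)" using card' other by (metis le_add1 order_refl)
      show "\<exists>i\<in>{..<m}. card (T i) < card (T' i)" using card' l by (intro bexI[of _ l]) auto
    qed simp
    ultimately show False by linarith
  qed
  have "(1 - \<beta>) * card ?V \<le> card (nbhd G (T i))" if i: "i < m" for i
  proof -
    have "T i \<noteq> {}" using T(3)[OF i] s0 by auto
    then have "min (K * card (T i)) ((1 - \<beta>) * card ?V) \<le> card (nbhd G (T i))"
      using X T(1)[OF i] unfolding expanding_def by blast
    moreover have "K * card (T l) \<le> K * card (T i)" using lmin[OF i] \<open>0 < K\<close> by simp
    ultimately show ?thesis using big by linarith
  qed
  then show ?thesis using T(1,2,4) by blast
qed

text \<open>Each \<open>N i\<close> misses at most a fraction \<beta> of \<open>V\<close>; as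
  \<open>m * \<beta> < 1\<close>, the \<open>m\<close> complements cannot cover
  \<open>V\<close>.\<close>

lemma common_element:
  fixes \<beta> :: real and m :: nat
  assumes V: "finite V" and "\<forall>i<m. N i \<subseteq> V \<and> (1 - \<beta>) * card V \<le> card (N i)"
    and "m * \<beta> < 1" and "V \<noteq> {}"
  shows "\<exists>v\<in>V. \<forall>i<m. v \<in> N i"
proof (rule ccontr)
  assume "\<not> ?thesis"
  then have "V \<subseteq> (\<Union>i<m. V - N i)" by blast
  then have "card V \<le> card (\<Union>i<m. V - N i)" using V by (intro card_mono) auto
  also have "\<dots> \<le> (\<Sum>i<m. card (V - N i))" by (rule card_UN_le) simp
  finally have "real (card V) \<le> (\<Sum>i<m. real (card (V - N i)))" by (simp flip: of_nat_sum)
  also have "\<dots> \<le> (\<Sum>i<m. \<beta> * card V)"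
  proof (rule sum_mono)
    fix i assume "i \<in> {..<m}"
    then have N: "N i \<subseteq> V" "(1 - \<beta>) * card V \<le> card (N i)" using assms(2) by auto
    have "card (V - N i) = card V - card (N i)" "card (N i) \<le> card V"
      using N(1) V by (auto intro: card_Diff_subset finite_subset card_mono)
    then show "real (card (V - N i)) \<le> \<beta> * card V" using N(2) by (simp add: of_nat_diff algebra_simps)
  qed
  also have "\<dots> = (m * \<beta>) * card V" by simp
  finally show False using assms(3,4) V by (simp add: mult_le_cancel_right1 card_gt_0_iff)
qed

section \<open>Placing as many pebbles as there are vertices\<close>

lemma card_unpebbled_le:
  assumes "finite V" and "sum \<phi> V = card V" and "\<forall>x\<in>V. \<phi> x \<le> m"
  shows "card {x \<in> V. \<phi> x = 0} \<le> m * card {x \<in> V. 2 \<le> \<phi> x}"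
proof -
  have "(\<Sum>x\<in>V. 1) + card {x \<in> V. \<phi> x = 0} = (\<Sum>x\<in>V. \<phi> x + (if \<phi> x = 0 then 1 else 0))"
    using assms by (simp add: sum.distrib sum.If_cases Int_def conj_commute)
  \<comment> \<open>With one pebble per vertex on average, every empty vertex is balanced by a
    surplus, which only vertices with two or more pebbles have, and at most \<open>m\<close>
    each.\<close>
  also have "\<dots> \<le> (\<Sum>x\<in>V. 1 + (if 2 \<le> \<phi> x then m else 0))"
    by (rule sum_mono) (use assms(3) in \<open>auto intro: le_SucI\<close>)
  also have "\<dots> = (\<Sum>x\<in>V. 1) + m * card {x \<in> V. 2 \<le> \<phi> x}"
    unfolding sum.distrib using assms(1) by (simp add: sum.If_cases Int_def conj_commute)
  finally show ?thesis by linarith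
qed

text \<open>The lower bound holds in every graph: with fewer pebbles than vertices, put at most one
  on each vertex and none on \<open>r\<close>; then no move is possible and \<open>r\<close> stays
  empty.\<close>

lemma class0I:
  assumes G: "is_graph G"
    and solv: "\<And>\<phi> r. pebbling_size G \<phi> = card (fst G) \<Longrightarrow> r \<in> fst G \<Longrightarrow> can_pebble G \<phi> r"
  shows "class0 G"
proof -
  let ?Q = "{p. \<forall>\<phi>. pebbling_size G \<phi> = p \<longrightarrow> (\<forall>x\<in>fst G. can_pebble G \<phi> x)}"
  have fin: "finite (fst G)" using G unfolding is_graph_def by blast
  have "pebbling_number G \<le> enat (card (fst G))"
    unfolding pebbling_number_def using solv by (intro INF_lower) blast
  moreover have "enat (card (fst G)) \<le> pebbling_number G"
    unfolding pebbling_number_def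
  proof (rule INF_greatest)
    fix p assume p: "p \<in> ?Q"
    show "enat (card (fst G)) \<le> enat p"
    proof (rule ccontr)
      assume "\<not> ?thesis"
      then have lt: "p < card (fst G)" by simp
      then obtain A where A: "A \<subseteq> fst G" "card A = p" "finite A"
        using obtain_subset_with_card_n by (metis less_imp_le)
      obtain r where r: "r \<in> fst G" "r \<notin> A"
        using A lt card_mono by (metis linorder_not_le subsetI)
      define \<phi> :: "'a \<Rightarrow> nat" where "\<phi> x = (if x \<in> A then 1 else 0)" for x
      have "pebbling_size G \<phi> = p"
        unfolding pebbling_size_def \<phi>_def using A fin by (simp add: sum.If_cases Int_absorb1)
      then obtain \<psi> where \<psi>: "(pebbling_move G)\<^sup>*\<^sup>* \<phi> \<psi>" "1 \<le> \<psi> r"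
        using p r unfolding can_pebble_def by blast
      have "\<not> pebbling_move G \<phi> \<psi>'" for \<psi>'
        unfolding pebbling_move_def \<phi>_def by auto
      then have "\<psi> = \<phi>" using \<psi>(1) by (metis converse_rtranclpE)
      then show False using \<psi>(2) r unfolding \<phi>_def by simp
    qed
  qed
  ultimately show ?thesis unfolding class0_def using G by simp
qed

text \<open>The vertices with two or more pebbles seed \<open>m\<close> disjoint charged sets whose
  neighbourhoods are large enough to share a vertex, and that vertex collects a pebble from each
  set.\<close>

lemma expanding_can_pebble_many:
  fixes K \<beta> :: real and m :: nat
  assumes G: "is_graph G" and X: "expanding K \<beta> G" and K: "4 * (real m)\<^sup>2 < K" and m: "1 \<le> m"
    and \<beta>: "m * \<beta> < 1"
    and Z: "card {x \<in> fst G. \<phi> x = 0} \<le> m * card {x \<in> fst G. 2 \<le> \<phi> x}"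
    and B: "m \<le> card {x \<in> fst G. 2 \<le> \<phi> x}"
  shows "\<exists>v\<in>fst G. \<exists>\<psi>. (pebbling_move G)\<^sup>*\<^sup>* \<phi> \<psi> \<and> m \<le> \<psi> v"
proof -
  let ?B = "{x \<in> fst G. 2 \<le> \<phi> x}"
  \<comment> \<open>Using nearly all of \<open>?B\<close> as seeds gives
    \<open>card ?B < m * (s0 + 1)\<close>. Hence the empty vertices and the used ones number at most
    \<open>2 * m * m * s\<close> each, which explains the bound
    \<open>4 * m * m < K\<close>.\<close>
  define s0 where "s0 = card ?B div m"
  have s0: "1 \<le> s0" unfolding s0_def using B m by (simp add: div_greater_zero_iff Suc_le_eq)
  have B_le: "card ?B < m * (s0 + 1)"
    unfolding s0_def using m dividend_less_times_div[of m "card ?B"] by simp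
  have growth: "real (m * card ?B + m * (s + 1)) < K * s" if s: "s0 \<le> s" for s
  proof -
    have "m * card ?B \<le> m * (m * (2 * s))"
    proof (rule mult_le_mono2)
      have "m * (s0 + 1) \<le> m * (2 * s)" using s s0 by (intro mult_le_mono2) simp
      then show "card ?B \<le> m * (2 * s)" using B_le by simp
    qed
    moreover have "m * (s + 1) \<le> m * (m * (2 * s))"
    proof (rule mult_le_mono2)
      have "s + 1 \<le> 1 * (2 * s)" using s s0 by simp
      also have "\<dots> \<le> m * (2 * s)" using m by (rule mult_le_mono1)
      finally show "s + 1 \<le> m * (2 * s)" .
    qed
    moreover have "4 * m\<^sup>2 * s = m * (m * (2 * s)) + m * (m * (2 * s))" by (simp add: power2_eq_square)
    ultimately have "m * card ?B + m * (s + 1) \<le> 4 * m\<^sup>2 * s" by linarith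
    then have "real (m * card ?B + m * (s + 1)) \<le> real (4 * m\<^sup>2 * s)" by (rule of_nat_mono)
    also have "\<dots> = 4 * (real m)\<^sup>2 * s" by simp
    also have "\<dots> < K * s" using K s s0 by simp
    finally show ?thesis .
  qed
  have "0 < K" using K by (smt (verit) zero_le_power2)
  moreover have "m * s0 \<le> card ?B" unfolding s0_def by simp
  ultimately obtain T where T: "\<forall>i<m. T i \<subseteq> fst G \<and> charged G \<phi> (T i) \<and>
      (1 - \<beta>) * card (fst G) \<le> card (nbhd G (T i))" "disjoint_family_on T {..<m}"
    using balanced_charged_family[OF G X _ m s0, of ?B \<phi> "m * card ?B"] Z growth by blast
  have fin: "finite (fst G)" using G unfolding is_graph_def by blast
  have "card ?B \<noteq> 0" using B m by linarith
  then have "?B \<noteq> {}" by (metis card.empty)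
  then have ne: "fst G \<noteq> {}" by blast
  have "\<forall>i<m. nbhd G (T i) \<subseteq> fst G \<and> (1 - \<beta>) * card (fst G) \<le> card (nbhd G (T i))"
    using T(1) nbhd_subset[OF G] by blast
  from common_element[OF fin this \<beta> ne] obtain v where
    v: "v \<in> fst G" "\<forall>i<m. v \<in> nbhd G (T i)" by blast
  show ?thesis
  proof (cases "\<exists>i<m. v \<in> T i")
    case False
    then have "\<exists>\<psi>. (pebbling_move G)\<^sup>*\<^sup>* \<phi> \<psi> \<and> \<psi> v = \<phi> v + card {..<m}"
      using charged_family_deliver[OF G, of "{..<m}" \<phi> T v] T v by blast
    then show ?thesis using v(1) by (auto intro!: bexI[of _ v])
  next
    \<comment> \<open>If the meeting vertex lies in a set \<open>T j\<close>, that set provides two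
      pebbles by its own charge and the other \<open>m - 1\<close> sets one each.\<close>
    case True
    then obtain j where j: "j < m" "v \<in> T j" by blast
    let ?I = "{..<m} - {j}"
    have dis: "v \<notin> T i" if "i \<in> ?I" for i
      using T(2) j that unfolding disjoint_family_on_def by blast
    have dI: "disjoint_family_on T ?I" using T(2) unfolding disjoint_family_on_def by blast
    obtain \<psi> where \<psi>: "(pebbling_move G)\<^sup>*\<^sup>* \<phi> \<psi>" "2 \<le> \<psi> v" "\<forall>x. x \<notin> T j \<longrightarrow> \<psi> x = \<phi> x"
      using T(1) j unfolding charged_def by blast
    have "charged G \<psi> (T i)" if i: "i \<in> ?I" for i
    proof -
      have "T i \<inter> T j = {}" using T(2) j(1) i unfolding disjoint_family_on_def by blast
      then have "\<forall>x\<in>T i. \<psi> x = \<phi> x" using \<psi>(3) by blast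
      then show ?thesis using T(1) i charged_cong by blast
    qed
    then obtain \<psi>' where "(pebbling_move G)\<^sup>*\<^sup>* \<psi> \<psi>'" "\<psi>' v = \<psi> v + card ?I"
      using charged_family_deliver[OF G, of ?I \<psi> T v] v dI dis by blast
    moreover have "card ?I = m - 1" using j by simp
    ultimately have "(pebbling_move G)\<^sup>*\<^sup>* \<phi> \<psi>'" "m \<le> \<psi>' v"
      using \<psi>(1,2) by (auto intro: rtranclp_trans)
    then show ?thesis using v(1) by blast
  qed
qed

text \<open>If \<open>r\<close> were unreachable, a largest charged set \<open>T\<close> around
  \<open>b\<close> would be bordered by empty vertices only and not be adjacent to \<open>r\<close>.
  These are too few to separate \<open>T\<close> from \<open>r\<close>: both sides would have more
  than half of the vertices.\<close>

lemma expanding_can_pebble_few: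
  fixes K \<beta> :: real and m :: nat
  assumes G: "is_graph G" and X: "expanding K \<beta> G" and K: "4 * (real m)\<^sup>2 < K" and m: "1 \<le> m"
    and \<beta>: "\<beta> \<le> 1 / 4" and n: "4 * m\<^sup>2 < card (fst G)"
    and b: "b \<in> fst G" "2 \<le> \<phi> b" and r: "r \<in> fst G"
    and Z: "card {x \<in> fst G. \<phi> x = 0} \<le> m\<^sup>2"
  shows "can_pebble G \<phi> r"
proof (rule ccontr)
  assume not_r: "\<not> can_pebble G \<phi> r"
  let ?V = "fst G" and ?Z = "{x \<in> fst G. \<phi> x = 0}"
  have fin: "finite ?V" using G unfolding is_graph_def by blast
  define P where "P T \<longleftrightarrow> b \<in> T \<and> T \<subseteq> ?V \<and> charged G \<phi> T" for T
  have Pb: "P {b}" unfolding P_def using b charged_if_ge_2[of "{b}"] by simp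
  have bound: "card T \<le> card ?V" if "P T" for T
    using that fin unfolding P_def by (intro card_mono) auto
  have "\<exists>T. P T \<and> (\<forall>T'. P T' \<longrightarrow> card T' \<le> card T)"
    by (rule ex_has_greatest_nat[of P, OF Pb, where b = "Suc (card ?V)"])
      (use bound in \<open>auto simp: less_Suc_eq_le\<close>)
  then obtain T where PT: "P T" and max: "\<And>T'. P T' \<Longrightarrow> card T' \<le> card T" by auto
  have T: "b \<in> T" "T \<subseteq> ?V" "charged G \<phi> T" using PT unfolding P_def by auto
  have finT: "finite T" using finite_subset[OF T(2) fin] .
  have NT: "nbhd G T \<subseteq> T \<union> ?Z"
  proof (rule ccontr)
    assume "\<not> ?thesis"
    then obtain w where w: "w \<in> nbhd G T" "w \<notin> T" "w \<notin> ?Z" by blast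
    have wV: "w \<in> ?V" using w(1) nbhd_subset[OF G T(2)] by blast
    have "P (insert w T)"
      using T wV charged_insert[OF G T(3), of w] w unfolding P_def by auto
    from max[OF this] show False using finT w(2) by simp
  qed
  have rN: "r \<notin> nbhd G T"
  proof
    assume "r \<in> nbhd G T"
    moreover have "r \<notin> T"
    proof
      assume "r \<in> T"
      then obtain \<psi> where "(pebbling_move G)\<^sup>*\<^sup>* \<phi> \<psi>" "2 \<le> \<psi> r"
        using T(3) unfolding charged_def by blast
      then show False using not_r unfolding can_pebble_def by (meson le_trans one_le_numeral)
    qed
    ultimately obtain \<psi> where "(pebbling_move G)\<^sup>*\<^sup>* \<phi> \<psi>" "\<psi> r = \<phi> r + 1"
      using charged_deliver[OF G T(3), of r \<phi>] by blast
    then show False using not_r unfolding can_pebble_def by (metis le_add2)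
  qed
  \<comment> \<open>Such a set gains at most \<open>m * m\<close> vertices, fewer than growth by
    \<open>K\<close> would require, so the other term of the minimum must apply.\<close>
  have large: "3 * card ?V \<le> 4 * (card S + m\<^sup>2)"
    if S: "S \<subseteq> ?V" "S \<noteq> {}" "nbhd G S \<subseteq> S \<union> ?Z" for S
  proof -
    have finS: "finite S" using finite_subset[OF S(1) fin] .
    have "card (nbhd G S) \<le> card (S \<union> ?Z)" using S(3) finS fin by (intro card_mono) auto
    also have "\<dots> \<le> card S + card ?Z" by (rule card_Un_le)
    finally have le: "real (card (nbhd G S)) \<le> card S + (real m)\<^sup>2"
      using Z by (simp flip: of_nat_power of_nat_add)
    have c1: "1 \<le> real (card S)" using finS S(2) by (simp add: Suc_le_eq card_gt_0_iff)
    have m2: "1 \<le> (real m)\<^sup>2" using m by (simp add: one_le_power)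
    have "4 * (real m)\<^sup>2 * card S < K * card S" using K c1 by (intro mult_strict_right_mono) auto
    moreover have "card S + (real m)\<^sup>2 \<le> (real m)\<^sup>2 * card S + (real m)\<^sup>2 * card S"
      using c1 m2 by (intro add_mono) (simp_all add: mult_le_cancel_right1 mult_le_cancel_left1)
    moreover have "0 \<le> (real m)\<^sup>2 * card S" by simp
    ultimately have "card S + (real m)\<^sup>2 < K * card S" by linarith
    moreover have "min (K * card S) ((1 - \<beta>) * card ?V) \<le> card (nbhd G S)"
      using X S(1,2) unfolding expanding_def by blast
    ultimately have "(1 - \<beta>) * card ?V \<le> card S + (real m)\<^sup>2" using le by linarith
    moreover have "3 / 4 * real (card ?V) \<le> (1 - \<beta>) * card ?V" using \<beta> by (intro mult_right_mono) auto
    ultimately have "real (3 * card ?V) \<le> real (4 * (card S + m\<^sup>2))" by simp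
    then show ?thesis by (simp only: of_nat_le_iff)
  qed
  \<comment> \<open>Both \<open>T\<close> and the part of the graph that it does not reach expand only into empty vertices, so each fills
    more than half of the graph.\<close>
  let ?S = "insert r (?V - nbhd G T - ?Z)"
  have "nbhd G ?S \<inter> T = {}"
  proof -
    have "{x, y} \<notin> snd G" if "x \<in> ?S" "y \<in> T" for x y
    proof
      assume "{x, y} \<in> snd G"
      then have "x \<in> nbhd G T" using that unfolding nbhd_def by (auto simp: insert_commute)
      then show False using that rN by blast
    qed
    moreover have "?S \<inter> T = {}" using rN subset_nbhd[of T G] by blast
    ultimately show ?thesis unfolding nbhd_def by blast
  qed
  moreover have SV: "?S \<subseteq> ?V" using r by blast
  ultimately have "nbhd G ?S \<subseteq> ?S \<union> ?Z" using nbhd_subset[OF G SV] NT by blast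
  then have S_large: "3 * card ?V \<le> 4 * (card ?S + m\<^sup>2)" using large[OF SV] by blast
  have T_large: "3 * card ?V \<le> 4 * (card T + m\<^sup>2)" using large[OF T(2) _ NT] T(1) by blast
  have ST: "card ?S + card T \<le> card ?V"
  proof -
    have "?S \<inter> T = {}" using rN subset_nbhd[of T G] by blast
    then have "card ?S + card T = card (?S \<union> T)"
      using finT finite_subset[OF SV fin] by (simp only: card_Un_disjoint)
    also have "\<dots> \<le> card ?V" using SV T(2) fin by (intro card_mono) auto
    finally show ?thesis .
  qed
  have "\<lbrakk>3 * N \<le> 4 * (a + c); 3 * N \<le> 4 * (b + c); a + b \<le> N\<rbrakk> \<Longrightarrow> N \<le> 4 * c"
    for N a b c :: nat by presburger
  from this[OF S_large T_large ST] show False using n by simp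
qed

text \<open>Any two vertices are joined by a walk of length \<open>2 * k\<close>, so
  \<open>m\<close> pebbles on one vertex reach every target. It remains to treat placements with at
  most \<open>m\<close> pebbles everywhere, according to whether \<open>m\<close> vertices hold two
  or more.\<close>

lemma expanding_class0:
  fixes K \<beta> :: real and k :: nat
  defines "m \<equiv> 2 ^ (2 * k)"
  assumes G: "is_graph G" and X: "expanding K \<beta> G" and K: "4 * (real m)\<^sup>2 < K"
    and k: "card (fst G) \<le> K ^ k" and \<beta>: "0 < \<beta>" "\<beta> \<le> 1 / 4" "m * \<beta> < 1" and n: "4 * m\<^sup>2 < card (fst G)"
  shows "class0 G"
proof (rule class0I[OF G])
  fix \<phi> r assume \<phi>: "pebbling_size G \<phi> = card (fst G)" and r: "r \<in> fst G"
  let ?Z = "{x \<in> fst G. \<phi> x = 0}" and ?B = "{x \<in> fst G. 2 \<le> \<phi> x}"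
  have fin: "finite (fst G)" using G unfolding is_graph_def by blast
  have m: "1 \<le> m" unfolding m_def by simp
  then have "1 \<le> (real m)\<^sup>2" by (simp add: one_le_power)
  then have K1: "1 \<le> K" using K by linarith
  have stack: "can_pebble G \<phi> r" if "(pebbling_move G)\<^sup>*\<^sup>* \<phi> \<psi>" "v \<in> fst G" "m \<le> \<psi> v" for \<psi> v
  proof -
    have "(v, r) \<in> adj_rel G ^^ (2 * k)" using expanding_diameter[OF G X K1 k \<beta>(1) _ that(2) r] \<beta>(2) by simp
    from moves_along_walk[OF G this, of 1 \<psi>] that(3) obtain \<psi>' where
      "(pebbling_move G)\<^sup>*\<^sup>* \<psi> \<psi>'" "1 \<le> \<psi>' r" unfolding m_def by auto
    then show ?thesis using that(1) unfolding can_pebble_def by (meson rtranclp_trans)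
  qed
  show "can_pebble G \<phi> r"
  proof (cases "\<forall>x\<in>fst G. \<phi> x \<le> m")
    case False
    then obtain v where "v \<in> fst G" "m \<le> \<phi> v" by (meson linear)
    then show ?thesis using stack[OF rtranclp.rtrancl_refl] by blast
  next
    case True
    then have Z: "card ?Z \<le> m * card ?B"
      using card_unpebbled_le[OF fin] \<phi> unfolding pebbling_size_def by blast
    show ?thesis
    proof (cases "m \<le> card ?B")
      case True
      from expanding_can_pebble_many[OF G X K m \<beta>(3) Z this] stack show ?thesis by blast
    next
      case False
      show ?thesis
      proof (cases "\<phi> r = 0")
        case True
        \<comment> \<open>An empty target makes the counting bound nontrivial: some vertex
          \<open>b\<close> must hold two pebbles.\<close>
        then have "r \<in> ?Z" using r by blast
        then have "card ?Z \<noteq> 0" using fin by auto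
        then have "card ?B \<noteq> 0" using Z by (metis le_zero_eq mult_0_right)
        then obtain b where b: "b \<in> fst G" "2 \<le> \<phi> b" by (metis (no_types, lifting) card.empty empty_Collect_eq)
        have "m * card ?B \<le> m * m" using False by simp
        then have "card ?Z \<le> m\<^sup>2" using Z unfolding power2_eq_square by (rule le_trans[rotated])
        then show ?thesis using expanding_can_pebble_few[where \<phi> = \<phi>, OF G X K m \<beta>(2) n b r] by blast
      next
        case False
        then show ?thesis unfolding can_pebble_def by (intro exI[of _ \<phi>]) auto
      qed
    qed
  qed
qed

subsection \<open>Expansion of random graphs\<close>

lemma card_cut_edges:
  assumes "S \<inter> W = {}"
  shows "card ((\<lambda>(x, y). {x, y}) ` (S \<times> W)) = card S * card W"
proof -
  have "inj_on (\<lambda>(x, y). {x, y}) (S \<times> W)"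
    using assms by (auto simp: inj_on_def doubleton_eq_iff)
  then show ?thesis by (simp add: card_image card_cartesian_product)
qed

text \<open>The event is a product: coordinates in \<open>F\<close> must be \<open>False\<close>,
  the others are free. By independence each edge of \<open>F\<close> contributes a factor
  \<open>1 - p\<close>.\<close>

lemma prob_no_edges:
  assumes F: "F \<subseteq> all_edges {..<n}" and p: "0 \<le> p" "p \<le> 1"
  shows "measure_pmf.prob (random_graph n p) {G. snd G \<inter> F = {}} = (1 - p) ^ card F"
proof -
  let ?E = "all_edges {..<n}"
  have fin: "finite ?E"
    by (rule finite_subset[of _ "Pow {..<n}"]) (auto simp: all_edges_def)
  define B where "B e = (if e \<in> F then {False} else UNIV)" for e
  have "(\<lambda>f. ({..<n}, {e \<in> ?E. f e})) -` {G. snd G \<inter> F = {}} = Pi ?E B"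
    using F unfolding B_def by (auto simp: Pi_def split: if_splits)
  then have "measure_pmf.prob (random_graph n p) {G. snd G \<inter> F = {}} =
      (\<Prod>e\<in>?E. measure_pmf.prob (bernoulli_pmf p) (B e))"
    unfolding random_graph_def by (simp add: measure_Pi_pmf_Pi[OF fin])
  also have "\<dots> = (\<Prod>e\<in>?E. if e \<in> F then 1 - p else 1)"
  proof (rule prod.cong[OF refl])
    fix e
    show "measure_pmf.prob (bernoulli_pmf p) (B e) = (if e \<in> F then 1 - p else 1)"
      using p unfolding B_def by (simp add: measure_pmf_single)
  qed
  also have "\<dots> = (1 - p) ^ card F" using fin F by (simp add: prod.If_cases Int_absorb1)
  finally show ?thesis .
qed

lemma is_graph_random_graph:
  "G \<in> set_pmf (random_graph n p) \<Longrightarrow> is_graph G \<and> fst G = {..<n}"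
  unfolding random_graph_def is_graph_def by auto

text \<open>A violating \<open>S\<close> of size \<open>s\<close> has no edge to the complement of
  \<open>U = nbhd G S\<close>, which has more than \<open>\<beta> * n\<close> vertices; this has
  probability at most \<open>exp (- \<beta> * p * n * s)\<close>. There are at most
  \<open>n ^ s * n ^ u\<close> pairs with \<open>u < K * s\<close>, and \<open>n * (n + 1)\<close>
  bounds the choices of sizes.\<close>

lemma prob_not_expanding_le:
  fixes K \<beta> p :: real
  assumes p: "0 \<le> p" "p \<le> 1" and n: "1 \<le> n"
    and neg: "(K + 1) * ln n \<le> \<beta> * (p * n)"
  shows "measure_pmf.prob (random_graph n p) {G. \<not> expanding K \<beta> G}
    \<le> n * (n + 1) * exp ((K + 1) * ln n - \<beta> * (p * n))"
proof -
  let ?M = "random_graph n p" and ?V = "{..<n}"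
  define q where "q = exp ((K + 1) * ln n - \<beta> * (p * n))"
  define I where "I = {(s, u). s \<in> {1..n} \<and> u \<in> {0..n} \<and> real u < K * s \<and> real u < (1 - \<beta>) * n}"
  \<comment> \<open>Union bound over pairs \<open>S \<subseteq> U\<close> of sizes \<open>s\<close> and \<open>u\<close> without edges from \<open>S\<close> to the complement of \<open>U\<close>.\<close>
  define C where "C = (\<lambda>(s, u). {S. S \<subseteq> ?V \<and> card S = s} \<times> {U. U \<subseteq> ?V \<and> card U = u})"
  define A where "A = (\<lambda>(S, U). {G::nat graph. S \<subseteq> U \<and> snd G \<inter> (\<lambda>(x, y). {x, y}) ` (S \<times> (?V - U)) = {}})"
  have finI: "finite I" unfolding I_def by (rule finite_subset[of _ "{1..n} \<times> {0..n}"]) auto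
  have finC: "finite (C i)" for i unfolding C_def by (cases i) auto
  have card_I: "card I \<le> n * (n + 1)"
  proof -
    have "card I \<le> card ({1..n} \<times> {0..n})" unfolding I_def by (rule card_mono) auto
    then show ?thesis by simp
  qed
  have "measure_pmf.prob ?M {G. \<not> expanding K \<beta> G} \<le> measure_pmf.prob ?M (\<Union>i\<in>I. \<Union>c\<in>C i. A c)"
  proof (rule measure_pmf.finite_measure_mono_AE)
    show "AE G in measure_pmf ?M. G \<in> {G. \<not> expanding K \<beta> G} \<longrightarrow> G \<in> (\<Union>i\<in>I. \<Union>c\<in>C i. A c)"
      unfolding AE_measure_pmf_iff
    proof (intro ballI impI)
      fix G assume "G \<in> set_pmf ?M" and "G \<in> {G. \<not> expanding K \<beta> G}"
      then have G: "is_graph G" "fst G = ?V" "\<not> expanding K \<beta> G" using is_graph_random_graph by auto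
      then obtain S where S: "S \<subseteq> ?V" "S \<noteq> {}" "card (nbhd G S) < min (K * card S) ((1 - \<beta>) * n)"
        unfolding expanding_def by (auto simp: not_le)
      let ?U = "nbhd G S"
      have finS: "finite S" using finite_subset[OF S(1)] by simp
      have U: "?U \<subseteq> ?V" using nbhd_subset[OF G(1)] S(1) G(2) by simp
      have "card ?U \<le> n" using card_mono[OF _ U] by simp
      moreover have "card S \<le> n" using card_mono[OF _ S(1)] by simp
      moreover have "1 \<le> card S" using finS S(2) by (simp add: Suc_le_eq card_gt_0_iff)
      ultimately have "(card S, card ?U) \<in> I" unfolding I_def using S(3) by auto
      moreover have "(S, ?U) \<in> C (card S, card ?U)" unfolding C_def using S(1) U by auto
      moreover have "G \<in> A (S, ?U)" unfolding A_def using subset_nbhd by (auto simp: nbhd_def)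
      ultimately show "G \<in> (\<Union>i\<in>I. \<Union>c\<in>C i. A c)" by blast
    qed
  qed simp
  also have "\<dots> \<le> (\<Sum>i\<in>I. measure_pmf.prob ?M (\<Union>c\<in>C i. A c))"
    by (rule measure_pmf.finite_measure_subadditive_finite) (use finI in auto)
  also have "\<dots> \<le> (\<Sum>i\<in>I. q)"
  proof (rule sum_mono)
    fix i assume "i \<in> I"
    then obtain s u where i: "i = (s, u)" and s: "1 \<le> s" "s \<le> n" and u: "real u < K * s" "real u < (1 - \<beta>) * n" "u \<le> n"
      unfolding I_def by auto
    have "measure_pmf.prob ?M (\<Union>c\<in>C i. A c) \<le> (\<Sum>c\<in>C i. measure_pmf.prob ?M (A c))"
      by (rule measure_pmf.finite_measure_subadditive_finite) (use finC in auto)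
    also have "\<dots> \<le> (\<Sum>c\<in>C i. exp (- (\<beta> * (p * n)) * s))"
    proof (rule sum_mono)
      fix c assume "c \<in> C i"
      then obtain S U where c: "c = (S, U)" and S: "S \<subseteq> ?V" "card S = s" and U: "U \<subseteq> ?V" "card U = u"
        unfolding C_def i by auto
      let ?F = "(\<lambda>(x, y). {x, y}) ` (S \<times> (?V - U))"
      show "measure_pmf.prob ?M (A c) \<le> exp (- (\<beta> * (p * n)) * s)"
      proof (cases "S \<subseteq> U")
        case False
        then show ?thesis unfolding A_def c by simp
      next
        case True
        have "{x, y} \<in> all_edges ?V" if "x \<in> S" "y \<in> ?V - U" for x y
          using that True S(1) unfolding all_edges_def by (cases "x = y") auto
        then have F: "?F \<subseteq> all_edges ?V" by auto
        have "card (?V - U) = n - u" using U by (simp add: card_Diff_subset finite_subset)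
        then have cF: "card ?F = s * (n - u)"
          using card_cut_edges[of S "?V - U"] True S(2) by auto
        have "measure_pmf.prob ?M (A c) = (1 - p) ^ card ?F"
          unfolding A_def c using True prob_no_edges[OF F p] by simp
        also have "\<dots> \<le> exp (- p) ^ card ?F" using p exp_ge_add_one_self[of "- p"] by (intro power_mono) auto
        also have "\<dots> = exp (- (p * (real s * (n - u))))" 
          unfolding cF using u(3) by (simp add: exp_of_nat_mult[symmetric] of_nat_diff mult_ac)
        also have "\<dots> \<le> exp (- (\<beta> * (p * n)) * s)"
        proof -
          have "\<beta> * n \<le> real n - u" using u(2) by (simp add: algebra_simps)
          then have "(p * s) * (\<beta> * n) \<le> (p * s) * (real n - u)" using p by (intro mult_left_mono) auto
          then show ?thesis using u(3) by (simp add: of_nat_diff mult_ac)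
        qed
        finally show ?thesis .
      qed
    qed
    also have "\<dots> = real (n choose s) * real (n choose u) * exp (- (\<beta> * (p * n)) * s)"
      unfolding C_def i by (simp add: card_cartesian_product n_subsets)
    also have "\<dots> \<le> exp (s * ln n) * exp (K * s * ln n) * exp (- (\<beta> * (p * n)) * s)"
    proof (intro mult_right_mono mult_mono)
      have npos: "0 < real n" using n by simp
      have pw: "real (n choose j) \<le> exp (j * ln n)" if "j \<le> n" for j
      proof -
        have "n choose j \<le> n ^ j" using binomial_le_pow[OF that] .
        then have "real (n choose j) \<le> real n ^ j" by (metis of_nat_le_iff of_nat_power)
        also have "\<dots> = exp (j * ln n)" using npos by (simp add: exp_of_nat_mult)
        finally show ?thesis .
      qed
      show "real (n choose s) \<le> exp (s * ln n)" using pw s by simp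
      have "u * ln n \<le> K * s * ln n" using u(1) n by (intro mult_right_mono) auto
      then show "real (n choose u) \<le> exp (K * s * ln n)" using pw[OF u(3)] by (smt (verit) exp_le_cancel_iff)
    qed auto
    also have "\<dots> = exp (s * ((K + 1) * ln n - \<beta> * (p * n)))"
      unfolding exp_add[symmetric] by (simp add: algebra_simps)
    \<comment> \<open>By \<open>neg\<close> the exponent is \<open>s\<close> times a nonpositive
      number, so \<open>s = 1\<close> is the worst case.\<close>
    also have "\<dots> \<le> q"
    proof -
      have "0 \<le> (real s - 1) * (\<beta> * (p * n) - (K + 1) * ln n)" using neg s by (intro mult_nonneg_nonneg) auto
      then show ?thesis unfolding q_def by (simp add: algebra_simps)
    qed
    finally show "measure_pmf.prob ?M (\<Union>c\<in>C i. A c) \<le> q" .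
  qed
  also have "\<dots> = card I * q" by simp
  also have "\<dots> \<le> real (n * (n + 1)) * q"
    using card_I by (intro mult_right_mono of_nat_mono) (auto simp: q_def)
  finally show ?thesis unfolding q_def by (simp only: of_nat_mult of_nat_add of_nat_1)
qed

section \<open>From expansion to the threshold\<close>

lemma prob_class0_tendsto_1:
  fixes e :: real
  assumes e: "0 < e" "e < 1"
  shows "(\<lambda>n. prob_property class0 n (real n powr (e - 1))) \<longlonglongrightarrow> 1"
proof -
  \<comment> \<open>For \<open>K = n powr (e / 2)\<close> this gives \<open>n \<le> K ^ k\<close>
    with \<open>k\<close> independent of \<open>n\<close>, so \<open>m\<close> and \<beta> are
    constants.\<close>
  define k where "k = nat \<lceil>2 / e\<rceil>"
  define m :: nat where "m = 2 ^ (2 * k)"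
  \<comment> \<open>Then \<open>m * \<beta> = 1 / 4\<close>, so that \<open>m\<close> neighbourhoods
    have a common vertex.\<close>
  define \<beta> :: real where "\<beta> = 1 / (4 * m)"
  have m: "1 \<le> m" unfolding m_def by simp
  have \<beta>: "0 < \<beta>" "\<beta> \<le> 1 / 4" "m * \<beta> < 1" using m unfolding \<beta>_def by (auto simp: field_simps)
  have ke: "1 \<le> e / 2 * k"
  proof -
    have "2 / e \<le> k" unfolding k_def using e by (simp add: of_nat_ceiling)
    then show ?thesis using e by (simp add: field_simps)
  qed
  let ?err = "\<lambda>n::nat. n * (n + 1) * exp ((n powr (e / 2) + 1) * ln n - \<beta> * (n powr (e - 1) * n))"
  \<comment> \<open>Here \<open>p * n\<close> is \<open>n powr e\<close>, which outgrows
    \<open>n powr (e / 2) * ln n\<close>; for the same reason \<open>?err\<close> tends to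
    0.\<close>
  have ev1: "\<forall>\<^sub>F n :: nat in sequentially. (n powr (e / 2) + 1) * ln n \<le> \<beta> * (n powr (e - 1) * n)"
    using e \<beta>(1) by real_asymp
  have ev2: "\<forall>\<^sub>F n :: nat in sequentially. 4 * (real m)\<^sup>2 < n powr (e / 2)"
    using e by real_asymp
  have "\<forall>\<^sub>F n in sequentially. 1 - ?err n \<le> prob_property class0 n (real n powr (e - 1))"
    using ev1 ev2 eventually_gt_at_top[of "4 * m\<^sup>2"]
  proof eventually_elim
    case (elim n)
    define K where "K = real n powr (e / 2)"
    let ?p = "real n powr (e - 1)"
    let ?M = "random_graph n ?p"
    have n: "1 \<le> n" using elim(3) by simp
    have p: "0 \<le> ?p" "?p \<le> 1" using n e powr_mono[of "e - 1" 0 "real n"] by auto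
    have "real n = real n powr 1" using n by simp
    also have "\<dots> \<le> real n powr (e / 2 * k)" using n ke by (intro powr_mono) auto
    also have "\<dots> = K ^ k" unfolding K_def using n by (simp only: powr_powr[symmetric]) (simp add: powr_realpow)
    finally have Kk: "n \<le> K ^ k" .
    have "measure_pmf.prob ?M {G. \<not> class0 G} \<le> measure_pmf.prob ?M {G. \<not> expanding K \<beta> G}"
    proof (rule measure_pmf.finite_measure_mono_AE)
      show "AE G in measure_pmf ?M. G \<in> {G. \<not> class0 G} \<longrightarrow> G \<in> {G. \<not> expanding K \<beta> G}"
        unfolding AE_measure_pmf_iff
      proof (intro ballI impI)
        fix G assume "G \<in> set_pmf ?M" and nc: "G \<in> {G. \<not> class0 G}"
        then have G: "is_graph G" "fst G = {..<n}" using is_graph_random_graph by auto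
        show "G \<in> {G. \<not> expanding K \<beta> G}"
          using expanding_class0[of G K \<beta> k] G nc elim(2,3) Kk \<beta> unfolding K_def m_def by auto
      qed
    qed simp
    also have "\<dots> \<le> ?err n"
      using prob_not_expanding_le[OF p n, of K \<beta>] elim(1) unfolding K_def by simp
    finally have "measure_pmf.prob ?M {G. \<not> class0 G} \<le> ?err n" .
    moreover have "measure_pmf.prob ?M {G. \<not> class0 G} = 1 - measure_pmf.prob ?M {G. class0 G}"
      using measure_pmf.prob_neg[of ?M class0] by simp
    ultimately show ?case unfolding prob_property_def by linarith
  qed
  moreover have "\<forall>\<^sub>F n in sequentially. prob_property class0 n (real n powr (e - 1)) \<le> 1"
    unfolding prob_property_def by (simp add: measure_pmf.prob_le_1)
  moreover have "(\<lambda>n. 1 - ?err n) \<longlonglongrightarrow> 1" using e \<beta>(1) by real_asymp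
  ultimately show ?thesis by (rule tendsto_sandwich[OF _ _ _ tendsto_const])
qed

theorem theorem3p1:
  fixes d :: real
  assumes "d > 0"
  shows "threshold class0 \<subseteq> o(\<lambda>n. (real n * log 2 (real n)) powr (1 / d) / real n)"
proof
  fix t :: "nat \<Rightarrow> real"
  let ?g = "\<lambda>n. (real n * log 2 (real n)) powr (1 / d) / real n"
  assume t: "t \<in> threshold class0"
  show "t \<in> o(?g)"
  proof (rule ccontr)
    assume "t \<notin> o(?g)"
    then obtain c where c: "0 < c" and freq: "\<exists>\<^sub>F n in sequentially. c * norm (?g n) < norm (t n)"
      by (auto simp: smallo_def not_eventually not_le)
    \<comment> \<open>Being below \<open>1 / d\<close>, the exponent makes
      \<open>n powr (e - 1)\<close> negligible against \<open>?g\<close>; being below 1, it keeps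
      this a probability.\<close>
    define e where "e = min (1 / 2) (1 / (2 * d))"
    have e: "0 < e" "e < 1" "e < 1 / d" using assms unfolding e_def by (auto simp: min_def field_simps)
    define q where "q n = real n powr (e - 1)" for n
    \<comment> \<open>Switching the edge probability off where \<open>t\<close> is small makes it negligible against \<open>t\<close> everywhere.\<close>
    define p where "p n = (if c * norm (?g n) < norm (t n) then q n else 0)" for n
    have q01: "0 \<le> q n \<and> q n \<le> 1" for n
      unfolding q_def using e powr_mono[of "e - 1" 0 "real n"] by (cases "n = 0") auto
    have qg: "q \<in> o(?g)" unfolding q_def using e assms by real_asymp
    have "p \<in> o(t)"
    proof (rule landau_o.smallI)
      fix c' :: real assume "0 < c'"
      then have "\<forall>\<^sub>F n in sequentially. norm (q n) \<le> c' * c * norm (?g n)"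
        using c by (intro landau_o.smallD[OF qg]) simp
      then show "\<forall>\<^sub>F n in sequentially. norm (p n) \<le> c' * norm (t n)"
      proof eventually_elim
        case (elim n)
        show ?case
        proof (cases "c * norm (?g n) < norm (t n)")
          case True
          then have "c' * (c * norm (?g n)) \<le> c' * norm (t n)" using \<open>0 < c'\<close> by (intro mult_left_mono) auto
          then show ?thesis using elim True unfolding p_def by (simp add: mult_ac)
        next
          case False
          then show ?thesis using \<open>0 < c'\<close> unfolding p_def by auto
        qed
      qed
    qed
    moreover have "0 \<le> p n \<and> p n \<le> 1" for n using q01 unfolding p_def by auto
    ultimately have "(\<lambda>n. prob_property class0 n (p n)) \<longlonglongrightarrow> 0"
      using t unfolding threshold_def by blast
    then have "\<forall>\<^sub>F n in sequentially. prob_property class0 n (p n) < 1 / 2"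
      by (rule order_tendstoD) simp
    moreover have "\<forall>\<^sub>F n in sequentially. 1 / 2 < prob_property class0 n (q n)"
      unfolding q_def by (rule order_tendstoD(1)[OF prob_class0_tendsto_1[OF e(1,2)]]) simp
    \<comment> \<open>Wherever \<open>p n = q n\<close> the two probability bounds conflict, so for
      large \<open>n\<close> the switch is always off.\<close>
    ultimately have "\<forall>\<^sub>F n in sequentially. \<not> c * norm (?g n) < norm (t n)"
      by eventually_elim (auto simp: p_def)
    then show False using freq by (simp add: frequently_def)
  qed
qed

end
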